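(* Let $(z_n,x_n,w_n,y_n,\tau_n)$ be generated by the PF-GRPDA algorithm (defined in the context). Then the primal step-sizes are uniformly bounded above: $$\tau_n\le U:=\sqrt{\rho\,c_{\max}}\qquad\forall n\ge 1,\qquad\text{where } c_{\max}:=\frac{\psi+1}{9\beta\psi\|K\|^2}.$$
   Context: Setting: $\mathbb H_1,\mathbb H_2$ are finite-dimensional real Hilbert spaces; $f:\mathbb H_1\to(-\infty,+\infty]$ and $g:\mathbb H_2\to(-\infty,+\infty]$ are proper, convex and lower semicontinuous; $K:\mathbb H_1\to\mathbb H_2$ is a nonzero linear operator with adjoint $K^*$ and operator norm $\|K\|$; $h:\mathbb H_1\to\mathbb R$ is convex, differentiable and locally smooth, i.e. for every compact $B\subseteq\mathbb H_1$ there is $L_B>0$ with $\|\nabla h(x)-\nabla h(y)\|\le L_B\|x-y\|$ for all $x,y\in B$. It is assumed that the saddle-point problem $\min_{x}\max_{y}\{f(x)+h(x)+\langle Kx,y\rangle-g^*(y)\}$ has at least one solution, where $g^*$ is the Fenchel conjugate of $g$. $\operatorname{Prox}_{\lambda f}(x)=\operatorname{argmin}_z\{f(z)+\frac1{2\lambda}\|z-x\|^2\}$. $\varphi=\frac{1+\sqrt5}{2}$. PF-GRPDA algorithm: choose $x_0\in\mathbb H_1$, $y_0\in\mathbb H_2$, $z_0=x_0$, $\beta>0$, $\psi\in(1,\varphi]$, $\rho=\psi^{-1}+\psi^{-2}$, a sequence $(\alpha_n)_{n\ge0}\subset(\epsilon,1/3]$ with $\epsilon>0$, $\theta_0=1$,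 $\tau_0>0$. For $n=1,2,\dots$: $z_n=\frac{\psi-1}{\psi}x_{n-1}+\frac1\psi z_{n-1}$; $x_n=\operatorname{Prox}_{\tau_{n-1}f}\big(z_n-\tau_{n-1}K^*y_{n-1}-\tau_{n-1}\nabla h(x_{n-1})\big)$; $\tau_n=\min\Big\{\rho\tau_{n-1},\ \frac{\alpha_n\alpha_{n-1}\psi\theta_{n-1}}{(L_n^2+\beta\psi\|K\|^2)\tau_{n-1}}\Big\}$, $\sigma_n=\beta\tau_n$, where $L_n=\frac{\|\nabla h(x_n)-\nabla h(x_{n-1})\|}{\|x_n-x_{n-1}\|}$ if $x_n\ne x_{n-1}$, and the convention $\frac00=+\infty$ is used, under which the update reduces to $\tau_n=\rho\tau_{n-1}$ if $x_n=x_{n-1}$; $w_n=\operatorname{Prox}_{\frac1{\sigma_n}g}\big(\frac{y_{n-1}}{\sigma_n}+Kx_n\big)$; $y_n=y_{n-1}+\sigma_n(Kx_n-w_n)$; $\theta_n=\psi\tau_n/\tau_{n-1}$.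
   Formalization: The bound is proved for every n ≥ 1 with x_n ≠ x_{n-1}; when x_n = x_{n-1} the update τ_n = ρτ_{n-1} has no cap and the claim fails, e.g. f = g = h = 0, K = id, x_0 = y_0 = 0 and τ_0 large. *)

theory Defs
  imports "HOL-Analysis.Analysis"
begin

definition proper_fun :: "('a \<Rightarrow> ereal) \<Rightarrow> bool" where
  "proper_fun f \<longleftrightarrow> (\<forall>x. f x \<noteq> -\<infinity>) \<and> (\<exists>x. f x \<noteq> \<infinity>)"

(* The weights are strictly between 0 and 1, so the product 0 * \<infinity> never occurs. *)
definition convex_fun :: "('a::real_vector \<Rightarrow> ereal) \<Rightarrow> bool" where
  "convex_fun f \<longleftrightarrow>
     (\<forall>x y. \<forall>t\<in>{0<..<1::real}.
        f ((1 - t) *\<^sub>R x + t *\<^sub>R y) \<le> ereal (1 - t) * f x + ereal t * f y)"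

definition lsc_fun :: "('a::topological_space \<Rightarrow> ereal) \<Rightarrow> bool" where
  "lsc_fun f \<longleftrightarrow> (\<forall>x. f x \<le> Liminf (at x) f)"

definition fenchel_conjugate :: "('a::real_inner \<Rightarrow> ereal) \<Rightarrow> 'a \<Rightarrow> ereal" where
  "fenchel_conjugate g y = (SUP u. ereal (u \<bullet> y) - g u)"

(* For a proper, convex, lower semicontinuous f and r > 0 the minimizer exists and is unique,
   so the choice made by arg_min is immaterial. *)
definition prox :: "real \<Rightarrow> ('a::real_inner \<Rightarrow> ereal) \<Rightarrow> 'a \<Rightarrow> 'a" where
  "prox r f v = arg_min (\<lambda>u. f u + ereal (1 / (2 * r) * (norm (u - v))\<^sup>2)) (\<lambda>_. True)"

definition gradient :: "('a::real_inner \<Rightarrow> real) \<Rightarrow> 'a \<Rightarrow> 'a" where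
  "gradient h x = (THE d. GDERIV h x :> d)"

definition locally_smooth :: "('a::real_inner \<Rightarrow> real) \<Rightarrow> bool" where
  "locally_smooth h \<longleftrightarrow>
     (\<forall>B. compact B \<longrightarrow>
        (\<exists>L>0. \<forall>x\<in>B. \<forall>y\<in>B. norm (gradient h x - gradient h y) \<le> L * norm (x - y)))"

definition lagrangian ::
  "('a::real_inner \<Rightarrow> ereal) \<Rightarrow> ('b::real_inner \<Rightarrow> ereal) \<Rightarrow> ('a \<Rightarrow> real) \<Rightarrow> ('a \<Rightarrow> 'b)
    \<Rightarrow> 'a \<Rightarrow> 'b \<Rightarrow> ereal" where
  "lagrangian f g h K x y = f x + ereal (h x) + ereal (K x \<bullet> y) - fenchel_conjugate g y"

(* A saddle point is sought in dom f \<times> dom g*; the Lagrangian values compared below then never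
   involve \<infinity> - \<infinity>. *)
definition saddle_point ::
  "('a::real_inner \<Rightarrow> ereal) \<Rightarrow> ('b::real_inner \<Rightarrow> ereal) \<Rightarrow> ('a \<Rightarrow> real) \<Rightarrow> ('a \<Rightarrow> 'b)
    \<Rightarrow> 'a \<Rightarrow> 'b \<Rightarrow> bool" where
  "saddle_point f g h K xs ys \<longleftrightarrow>
     f xs < \<infinity> \<and> fenchel_conjugate g ys < \<infinity> \<and>
     (\<forall>x y. lagrangian f g h K xs y \<le> lagrangian f g h K xs ys \<and>
            lagrangian f g h K xs ys \<le> lagrangian f g h K x ys)"

definition local_lipschitz :: "('a::real_inner \<Rightarrow> real) \<Rightarrow> 'a \<Rightarrow> 'a \<Rightarrow> real" where
  "local_lipschitz h x x' = norm (gradient h x - gradient h x') / norm (x - x')"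

definition grpda_rho :: "real \<Rightarrow> real" where
  "grpda_rho \<psi> = 1 / \<psi> + 1 / \<psi>\<^sup>2"

(* The case distinction in the update of \<tau> renders the convention 0/0 = +\<infinity>
   (Isabelle's own convention would be 0/0 = 0).  Hence \<tau> is multiplied by \<rho> without any cap
   whenever an iterate is repeated. *)
definition pf_grpda ::
  "('a::euclidean_space \<Rightarrow> ereal) \<Rightarrow> ('b::euclidean_space \<Rightarrow> ereal) \<Rightarrow> ('a \<Rightarrow> real) \<Rightarrow> ('a \<Rightarrow> 'b)
    \<Rightarrow> real \<Rightarrow> real \<Rightarrow> (nat \<Rightarrow> real)
    \<Rightarrow> (nat \<Rightarrow> 'a) \<Rightarrow> (nat \<Rightarrow> 'a) \<Rightarrow> (nat \<Rightarrow> 'b) \<Rightarrow> (nat \<Rightarrow> 'b)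
    \<Rightarrow> (nat \<Rightarrow> real) \<Rightarrow> (nat \<Rightarrow> real) \<Rightarrow> (nat \<Rightarrow> real) \<Rightarrow> bool" where
  "pf_grpda f g h K \<beta> \<psi> \<alpha> z x w y \<tau> \<sigma> \<theta> \<longleftrightarrow>
     z 0 = x 0 \<and> \<theta> 0 = 1 \<and> \<tau> 0 > 0 \<and>
     (\<forall>n\<ge>1.
        z n = ((\<psi> - 1) / \<psi>) *\<^sub>R x (n - 1) + (1 / \<psi>) *\<^sub>R z (n - 1) \<and>
        x n = prox (\<tau> (n - 1)) f
                (z n - \<tau> (n - 1) *\<^sub>R adjoint K (y (n - 1)) - \<tau> (n - 1) *\<^sub>R gradient h (x (n - 1))) \<and>
        \<tau> n = (if x n = x (n - 1) then grpda_rho \<psi> * \<tau> (n - 1)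
               else min (grpda_rho \<psi> * \<tau> (n - 1))
                      (\<alpha> n * \<alpha> (n - 1) * \<psi> * \<theta> (n - 1) /
                        (((local_lipschitz h (x n) (x (n - 1)))\<^sup>2 + \<beta> * \<psi> * (onorm K)\<^sup>2) * \<tau> (n - 1)))) \<and>
        \<sigma> n = \<beta> * \<tau> n \<and>
        w n = prox (1 / \<sigma> n) g ((1 / \<sigma> n) *\<^sub>R y (n - 1) + K (x n)) \<and>
        y n = y (n - 1) + \<sigma> n *\<^sub>R (K (x n) - w n) \<and>
        \<theta> n = \<psi> * \<tau> n / \<tau> (n - 1))"

end

theory Submission
  imports Defs
begin

text \<open>
  The growth cap gives \<open>\<tau>\<^sub>n \<le> \<rho> \<tau>\<^sub>n\<^sub>-\<^sub>1\<close>, so \<open>\<theta>\<^sub>n\<^sub>-\<^sub>1 \<le> \<psi> \<rho> = 1 + 1 / \<psi>\<close>; the curvature cap bounds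
  \<open>\<tau>\<^sub>n \<tau>\<^sub>n\<^sub>-\<^sub>1\<close> by \<open>\<theta>\<^sub>n\<^sub>-\<^sub>1 / (9 \<beta> \<parallel>K\<parallel>\<^sup>2)\<close>. Both caps together bound
  \<open>\<tau>\<^sub>n\<^sup>2 \<le> \<rho> \<tau>\<^sub>n \<tau>\<^sub>n\<^sub>-\<^sub>1\<close>.
\<close>

lemma grpda_rho_pos: "\<psi> > 0 \<Longrightarrow> grpda_rho \<psi> > 0"
  by (simp add: grpda_rho_def add_pos_pos)

lemma mult_grpda_rho: "\<psi> > 0 \<Longrightarrow> \<psi> * grpda_rho \<psi> = (\<psi> + 1) / \<psi>"
  by (simp add: grpda_rho_def field_simps power2_eq_square)

lemma linear_onorm_pos:
  fixes K :: "'a::euclidean_space \<Rightarrow> 'b::real_normed_vector"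
  assumes "linear K" "K \<noteq> (\<lambda>_. 0)"
  shows "onorm K > 0"
  using assms onorm_pos_lt[of K] linear_conv_bounded_linear[of K] by auto

text \<open>Isolates the step-size recursion and shifts it from \<open>n\<close> and
  \<open>n - 1\<close> to \<open>Suc n\<close> and \<open>n\<close>, the form suited to
  induction.\<close>

lemma pf_grpda_stepsize:
  assumes "pf_grpda f g h K \<beta> \<psi> \<alpha> z x w y \<tau> \<sigma> \<theta>"
  shows "\<theta> 0 = 1" "\<tau> 0 > 0"
    and "\<theta> (Suc n) = \<psi> * \<tau> (Suc n) / \<tau> n"
    and "\<tau> (Suc n) = (if x (Suc n) = x n then grpda_rho \<psi> * \<tau> n
           else min (grpda_rho \<psi> * \<tau> n)
                  (\<alpha> (Suc n) * \<alpha> n * \<psi> * \<theta> n /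
                    (((local_lipschitz h (x (Suc n)) (x n))\<^sup>2 + \<beta> * \<psi> * (onorm K)\<^sup>2) * \<tau> n)))"
proof -
  show "\<theta> 0 = 1" "\<tau> 0 > 0"
    using assms by (auto simp only: pf_grpda_def)
  have "1 \<le> Suc n" by simp
  with assms show "\<theta> (Suc n) = \<psi> * \<tau> (Suc n) / \<tau> n"
    and "\<tau> (Suc n) = (if x (Suc n) = x n then grpda_rho \<psi> * \<tau> n
           else min (grpda_rho \<psi> * \<tau> n)
                  (\<alpha> (Suc n) * \<alpha> n * \<psi> * \<theta> n /
                    (((local_lipschitz h (x (Suc n)) (x n))\<^sup>2 + \<beta> * \<psi> * (onorm K)\<^sup>2) * \<tau> n)))"
    unfolding pf_grpda_def by (metis diff_Suc_1)+
qed

text \<open>The two signs need a joint induction: the curvature cap for the next \<tau> contains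
  \<theta>, and the next \<theta> is a quotient of step sizes.\<close>

lemma pf_grpda_pos:
  assumes alg: "pf_grpda f g h K \<beta> \<psi> \<alpha> z x w y \<tau> \<sigma> \<theta>"
    and pos: "\<beta> > 0" "\<psi> > 0" "onorm K > 0" "\<And>n. \<alpha> n > 0"
  shows "\<tau> n > 0 \<and> \<theta> n > 0"
proof (induction n)
  case 0
  show ?case using pf_grpda_stepsize(1,2)[OF alg] by simp
next
  case (Suc n)
  \<comment> \<open>The term with \<open>onorm K\<close> keeps the denominator positive even where
    the gradient does not change.\<close>
  have "(local_lipschitz h (x (Suc n)) (x n))\<^sup>2 + \<beta> * \<psi> * (onorm K)\<^sup>2 > 0"
    using pos by (simp add: add_nonneg_pos)
  then have "\<tau> (Suc n) > 0"
    using Suc pos grpda_rho_pos[of \<psi>] unfolding pf_grpda_stepsize(4)[OF alg, of n]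
    by simp
  then show ?case
    using Suc pos by (simp add: pf_grpda_stepsize(3)[OF alg])
qed

text \<open>The growth cap holds in both branches of the update, so repeated iterates are covered as
  well. The bound is \<psi> times \<open>grpda_rho \<psi>\<close>.\<close>

lemma pf_grpda_theta_le:
  assumes alg: "pf_grpda f g h K \<beta> \<psi> \<alpha> z x w y \<tau> \<sigma> \<theta>"
    and pos: "\<beta> > 0" "\<psi> > 0" "onorm K > 0" "\<And>n. \<alpha> n > 0"
  shows "\<theta> n \<le> (\<psi> + 1) / \<psi>"
proof (cases n)
  case 0
  \<comment> \<open>The initial \<theta> is set to 1 rather than formed as a quotient, and 1 lies
    below 1 + 1 / \<psi>.\<close>
  then show ?thesis using pf_grpda_stepsize(1)[OF alg] pos by simp
next
  case (Suc m)
  have "\<tau> m > 0" using pf_grpda_pos[OF assms] by simp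
  moreover have "\<tau> n \<le> grpda_rho \<psi> * \<tau> m"
    unfolding Suc pf_grpda_stepsize(4)[OF alg, of m] by simp
  ultimately have "\<psi> * (\<tau> n / \<tau> m) \<le> \<psi> * grpda_rho \<psi>"
    using pos by (simp add: pos_divide_le_eq)
  then show ?thesis
    using pos by (simp add: Suc pf_grpda_stepsize(3)[OF alg] mult_grpda_rho)
qed

text \<open>Distinct iterates select the branch of the update that contains the curvature
  cap.\<close>

lemma pf_grpda_stepsize_mult_le:
  assumes alg: "pf_grpda f g h K \<beta> \<psi> \<alpha> z x w y \<tau> \<sigma> \<theta>"
    and pos: "\<beta> > 0" "\<psi> > 0" "onorm K > 0" "\<And>n. \<alpha> n > 0"
    and bound: "\<And>n. \<alpha> n \<le> 1 / 3"
    and neq: "x (Suc n) \<noteq> x n"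
  shows "\<tau> (Suc n) * \<tau> n \<le> (\<psi> + 1) / (9 * \<beta> * \<psi> * (onorm K)\<^sup>2)"
proof -
  define D where "D = (local_lipschitz h (x (Suc n)) (x n))\<^sup>2 + \<beta> * \<psi> * (onorm K)\<^sup>2"
  have tau: "\<tau> n > 0" and theta: "\<theta> n > 0"
    using pf_grpda_pos[OF alg pos] by auto
  have kpos: "\<beta> * \<psi> * (onorm K)\<^sup>2 > 0" using pos by simp
  have D: "D \<ge> \<beta> * \<psi> * (onorm K)\<^sup>2" by (simp add: D_def)
  have "\<tau> (Suc n) \<le> \<alpha> (Suc n) * \<alpha> n * \<psi> * \<theta> n / (D * \<tau> n)"
    using neq unfolding pf_grpda_stepsize(4)[OF alg, of n] D_def by simp
  then have "\<tau> (Suc n) * \<tau> n \<le> \<alpha> (Suc n) * \<alpha> n * (\<psi> * \<theta> n) / D"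
    using tau D kpos by (simp add: field_simps)
  \<comment> \<open>The 9 comes from two factors \<alpha>, each at most 1/3; the squared Lipschitz
    quotient is dropped from the denominator.\<close>
  also have "\<dots> \<le> (1 / 3 * (1 / 3)) * (\<psi> * \<theta> n) / (\<beta> * \<psi> * (onorm K)\<^sup>2)"
    using pos theta bound D kpos
    by (intro frac_le mult_mono mult_nonneg_nonneg) (auto intro: less_imp_le)
  \<comment> \<open>The \<psi> of the cap cancels here; the \<psi> in the final denominator comes
    from the bound on \<theta>.\<close>
  also have "\<dots> = \<theta> n / (9 * \<beta> * (onorm K)\<^sup>2)"
    using pos by (simp add: field_simps)
  also have "\<dots> \<le> (\<psi> + 1) / \<psi> / (9 * \<beta> * (onorm K)\<^sup>2)"
    using pos by (intro divide_right_mono pf_grpda_theta_le[OF alg pos]) auto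
  finally show ?thesis by (simp add: mult_ac)
qed

text \<open>The bound is restricted to steps with a new iterate: a repeated one multiplies \<tau> by
  \<rho> without a cap, and as \<tau> may start arbitrarily large, \<open>U\<close> can then be
  exceeded.\<close>

theorem mainTheorem1:
  fixes f :: "'a::euclidean_space \<Rightarrow> ereal"
    and g :: "'b::euclidean_space \<Rightarrow> ereal"
    and h :: "'a \<Rightarrow> real"
    and K :: "'a \<Rightarrow> 'b"
    and \<beta> \<psi> \<epsilon> c_max U :: real
    and \<alpha> \<tau> \<sigma> \<theta> :: "nat \<Rightarrow> real"
    and z x :: "nat \<Rightarrow> 'a"
    and w y :: "nat \<Rightarrow> 'b"
  assumes "proper_fun f" "convex_fun f" "lsc_fun f"
    and "proper_fun g" "convex_fun g" "lsc_fun g"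
    and "linear K" "K \<noteq> (\<lambda>_. 0)"
    and "convex_on UNIV h" "\<forall>u. h differentiable (at u)" "locally_smooth h"
    and "\<exists>xs ys. saddle_point f g h K xs ys"
    and "\<beta> > 0" "1 < \<psi>" "\<psi> \<le> (1 + sqrt 5) / 2"
    and "\<epsilon> > 0" "\<forall>n. \<epsilon> < \<alpha> n \<and> \<alpha> n \<le> 1 / 3"
    and "pf_grpda f g h K \<beta> \<psi> \<alpha> z x w y \<tau> \<sigma> \<theta>"
    and "c_max = (\<psi> + 1) / (9 * \<beta> * \<psi> * (onorm K)\<^sup>2)"
    and "U = sqrt (grpda_rho \<psi> * c_max)"
  shows "\<forall>n\<ge>1. x n \<noteq> x (n - 1) \<longrightarrow> \<tau> n \<le> U"
proof (intro allI impI)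
  fix n :: nat
  assume "n \<ge> 1" and neq: "x n \<noteq> x (n - 1)"
  then obtain m where n: "n = Suc m" by (cases n) auto
  have psi: "\<psi> > 0" using \<open>1 < \<psi>\<close> by simp
  have alpha: "\<alpha> k > 0" "\<alpha> k \<le> 1 / 3" for k
    using \<open>\<epsilon> > 0\<close> \<open>\<forall>n. \<epsilon> < \<alpha> n \<and> \<alpha> n \<le> 1 / 3\<close> less_trans by blast+
  note K = linear_onorm_pos[OF \<open>linear K\<close> \<open>K \<noteq> (\<lambda>_. 0)\<close>]
  note alg = \<open>pf_grpda f g h K \<beta> \<psi> \<alpha> z x w y \<tau> \<sigma> \<theta>\<close>
  have pos: "\<tau> k > 0" for k
    using pf_grpda_pos[OF alg \<open>\<beta> > 0\<close> psi K alpha(1)] by simp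
  have "\<tau> n \<le> grpda_rho \<psi> * \<tau> m"
    unfolding n pf_grpda_stepsize(4)[OF alg, of m] by simp
  \<comment> \<open>Multiplying the growth cap by \<open>\<tau> n\<close> produces the product of
    consecutive step sizes that the curvature cap controls.\<close>
  then have "(\<tau> n)\<^sup>2 \<le> grpda_rho \<psi> * (\<tau> n * \<tau> m)"
    using mult_left_mono[of "\<tau> n" _ "\<tau> n"] pos[of n]
    by (simp add: power2_eq_square mult_ac)
  also have "\<dots> \<le> grpda_rho \<psi> * c_max"
    using pf_grpda_stepsize_mult_le[OF alg \<open>\<beta> > 0\<close> psi K alpha] neq grpda_rho_pos[OF psi]
      \<open>c_max = _\<close>
    by (intro mult_left_mono) (auto simp: n)
  finally show "\<tau> n \<le> U"
    using \<open>U = _\<close> by (simp add: real_le_rsqrt)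
qed

end
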